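(* Let $\tau>0$ and let $\gamma,r:[0,\infty)\to(0,\infty)$ be measurable. The solution to the deterministic Mackey--Glass equation $$x'(t)=-\gamma(t)x(t)+r(t)\frac{x(t-\tau)}{1+x(t-\tau)^p},$$ with initial value $x_0=\varphi$, is bounded away from zero, i.e. $\inf_{t\ge0}x(t)>0$, provided that $$p>1,\qquad \inf_{t\in[-\tau,0]}\varphi(t)>0,\qquad \liminf_{t\to\infty}\frac{r(t)}{\gamma(t)}>1.$$ Furthermore, if in addition $\gamma$ and $r$ are constants, then $r>\gamma$ and the equation admits a non-trivial invariant measure $\nu$ on $C[-\tau,0]$, and hence a stationary distribution $\mu$ with $\mu([m,M])=1$ for some $m,M>0$.
   Context: $C[-\tau,0]$ is the space of continuous real functions on $[-\tau,0]$ with the supremum norm. The initial function $\varphi$ is a càdlàg real function on $[-\tau,0]$; $x_t=(x(t+\theta))_{\theta\in[-\tau,0]}$ is the segment of the solution at time $t$, so that $x_0=\varphi$ is the initial condition. A Borel probability measure $\nu$ on $C[-\tau,0]$ is an invariant measure of the (autonomous) equation if, when the initial segment is a random variable with law $\nu$, the segment $x_t$ has law $\nu$ for every $t\ge0$. The push-forward of $\nu$ under $\varphi\mapsto\varphi(0)$ is then a stationary distribution (a probability measure on $\mathbb R$ that is the law of $x(t)$ for all $t\ge 0$ for some random initial segment). Non-trivial means distinct from the Dirac measure associated with the fixed point $x=0$.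
   Formalization: Boundedness away from zero is stated for locally integrable γ with either limsup r/γ finite or the integrals of γ over [t,t+τ] uniformly bounded in t; for merely measurable γ, r the claim as printed fails. The constant-coefficient part is unchanged. *)

theory Defs
  imports "HOL-Probability.Probability"
begin

definition cadlag_on :: "real \<Rightarrow> real \<Rightarrow> (real \<Rightarrow> real) \<Rightarrow> bool" where
  "cadlag_on a b f \<longleftrightarrow>
     (\<forall>t\<in>{a..<b}. (f \<longlongrightarrow> f t) (at_right t)) \<and>
     (\<forall>t\<in>{a<..b}. \<exists>l. (f \<longlongrightarrow> l) (at_left t))"

text \<open>The coefficients are merely measurable, so a solution is meant in the sense of Caratheodory,
  that is, in integrated form. For \<open>x < 0\<close> the library has \<open>x powr p = \<bar>x\<bar> powr p\<close>, so the right-hand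
  side is total and locally Lipschitz; for \<open>x \<ge> 0\<close> it is the Mackey--Glass nonlinearity.\<close>

definition MG_rhs ::
  "real \<Rightarrow> real \<Rightarrow> (real \<Rightarrow> real) \<Rightarrow> (real \<Rightarrow> real) \<Rightarrow> (real \<Rightarrow> real) \<Rightarrow> real \<Rightarrow> real" where
  "MG_rhs \<tau> p \<gamma> r x t = - \<gamma> t * x t + r t * (x (t - \<tau>) / (1 + x (t - \<tau>) powr p))"

definition MG_solution ::
  "real \<Rightarrow> real \<Rightarrow> (real \<Rightarrow> real) \<Rightarrow> (real \<Rightarrow> real) \<Rightarrow> (real \<Rightarrow> real) \<Rightarrow> (real \<Rightarrow> real) \<Rightarrow> bool" where
  "MG_solution \<tau> p \<gamma> r \<phi> x \<longleftrightarrow>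
     (\<forall>\<theta>\<in>{-\<tau>..0}. x \<theta> = \<phi> \<theta>) \<and>
     (\<forall>t\<ge>0. integrable (lebesgue_on {0..t}) (MG_rhs \<tau> p \<gamma> r x) \<and>
            x t = \<phi> 0 + integral\<^sup>L (lebesgue_on {0..t}) (MG_rhs \<tau> p \<gamma> r x))"

text \<open>\<open>C[-\<tau>,0]\<close> with the supremum metric; its elements are extensional on \<open>[-\<tau>,0]\<close>.\<close>

definition C_space :: "real \<Rightarrow> (real \<Rightarrow> real) metric" where
  "C_space \<tau> = cfunspace (top_of_set {-\<tau>..0}) euclidean_metric"

definition C_borel :: "real \<Rightarrow> (real \<Rightarrow> real) measure" where
  "C_borel \<tau> = sigma (mspace (C_space \<tau>)) {U. openin (mtopology_of (C_space \<tau>)) U}"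

definition segment :: "real \<Rightarrow> (real \<Rightarrow> real) \<Rightarrow> real \<Rightarrow> (real \<Rightarrow> real)" where
  "segment \<tau> x t = (\<lambda>\<theta>\<in>{-\<tau>..0}. x (t + \<theta>))"

text \<open>A process whose paths solve the autonomous equation with rates \<open>g\<close> and \<open>k\<close>, started from a
  random initial segment in \<open>C[-\<tau>,0]\<close>. The sample space is a subset of the type
  \<^typ>\<open>real \<Rightarrow> real\<close>, which contains \<open>C[-\<tau>,0]\<close>, so every law on \<open>C[-\<tau>,0]\<close> can occur as the law
  of the initial segment.\<close>

definition MG_process ::
  "real \<Rightarrow> real \<Rightarrow> real \<Rightarrow> real \<Rightarrow> (real \<Rightarrow> real) measure \<Rightarrow> ((real \<Rightarrow> real) \<Rightarrow> real \<Rightarrow> real) \<Rightarrow> bool"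
  where
  "MG_process \<tau> p g k P X \<longleftrightarrow>
     prob_space P \<and>
     (\<forall>t\<ge>0. (\<lambda>\<omega>. segment \<tau> (X \<omega>) t) \<in> P \<rightarrow>\<^sub>M C_borel \<tau>) \<and>
     (AE \<omega> in P. MG_solution \<tau> p (\<lambda>_. g) (\<lambda>_. k) (segment \<tau> (X \<omega>) 0) (X \<omega>))"

text \<open>The existential conjunct keeps the universal one from holding vacuously.\<close>

definition MG_invariant :: "real \<Rightarrow> real \<Rightarrow> real \<Rightarrow> real \<Rightarrow> (real \<Rightarrow> real) measure \<Rightarrow> bool" where
  "MG_invariant \<tau> p g k \<nu> \<longleftrightarrow>
     prob_space \<nu> \<and> sets \<nu> = sets (C_borel \<tau>) \<and>
     (\<exists>P X. MG_process \<tau> p g k P X \<and> distr P (C_borel \<tau>) (\<lambda>\<omega>. segment \<tau> (X \<omega>) 0) = \<nu>) \<and>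
     (\<forall>P X. MG_process \<tau> p g k P X \<and> distr P (C_borel \<tau>) (\<lambda>\<omega>. segment \<tau> (X \<omega>) 0) = \<nu> \<longrightarrow>
        (\<forall>t\<ge>0. distr P (C_borel \<tau>) (\<lambda>\<omega>. segment \<tau> (X \<omega>) t) = \<nu>))"

definition MG_stationary :: "real \<Rightarrow> real \<Rightarrow> real \<Rightarrow> real \<Rightarrow> real measure \<Rightarrow> bool" where
  "MG_stationary \<tau> p g k \<mu> \<longleftrightarrow>
     prob_space \<mu> \<and> sets \<mu> = sets borel \<and>
     (\<exists>P X. MG_process \<tau> p g k P X \<and> (\<forall>t\<ge>0. distr P borel (\<lambda>\<omega>. X \<omega> t) = \<mu>))"

text \<open>Measurability of \<open>\<gamma>\<close> and \<open>r\<close> together with \<open>liminf r/\<gamma> > 1\<close> does not give persistence.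
  If \<open>\<gamma>\<close> is not locally integrable, a solution may reach zero in finite time, as with
  \<open>\<gamma>(t) = 1/\<bar>1-t\<bar>\<close> and \<open>r(t) = (1-t)^2\<close> for \<open>t\<close> close to but
  different from \<open>1\<close>. If \<open>\<gamma>\<close> is locally integrable but both \<open>r/\<gamma>\<close> and the integrals of \<open>\<gamma>\<close> over windows of length \<open>\<tau>\<close> are unbounded, the infimum may still be
  zero: take \<open>\<tau> = 1\<close>, let \<open>r/\<gamma>\<close> be \<open>2\<close> on \<open>[2j+1,2j+2)\<close> and a large constant on \<open>[2j,2j+1)\<close>, and let
  \<open>\<gamma>\<close> be a large constant on each of these intervals. On \<open>[2j,2j+1)\<close> the solution then becomes
  large, and since \<open>y/(1+y^p)\<close> tends to zero as \<open>y\<close> tends to infinity, it becomes arbitrarily small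
  on \<open>[2j+1,2j+2)\<close>. The persistence statement therefore assumes local integrability of \<open>\<gamma>\<close> and
  that \<open>r/\<gamma>\<close> is eventually bounded or \<open>\<gamma>\<close> is uniformly locally integrable; constant rates
  satisfy both.\<close>

end

theory Submission
  imports Defs
begin

text \<open>
  Write \<open>f y = y / (1 + y powr p)\<close> and let \<open>\<rho> > 1\<close> be such that \<open>r \<ge> \<rho> \<gamma>\<close> eventually. If \<open>\<rho> f (x (t - \<tau>)) \<ge> m\<close>
  whenever \<open>x (t - \<tau>) \<ge> m \<ge> x t\<close>, then \<open>x' \<ge> \<gamma> (m - x) \<ge> 0\<close> on \<open>{x \<le> m}\<close>, so \<open>x\<close> cannot cross the level \<open>m\<close>
  downwards, delay interval after delay interval. Since \<open>\<rho> f y \<ge> y\<close> for small \<open>y\<close>, only large delayed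
  values are a danger. If \<open>r / \<gamma>\<close> is bounded, so is \<open>x\<close>, and \<open>f\<close> is bounded below on \<open>[m, sup x]\<close>. If the
  integrals of \<open>\<gamma>\<close> over windows of length \<open>\<tau>\<close> are bounded, \<open>x\<close> loses at most a fixed factor over such a
  window, so \<open>x (t - \<tau>)\<close> is small whenever \<open>x t\<close> is.

  For constant rates the Dirac measure at the positive equilibrium \<open>(k / g - 1) powr (1 / p)\<close> is
  invariant; the same barrier argument, applied from both sides, shows that the constant solution
  is the only one with that initial segment.
\<close>

section \<open>Barriers for functions given by the integral of a rate\<close>

lemma continuous_on_if_has_integral_increments:
  fixes x F :: "real \<Rightarrow> real"
  assumes "\<And>v. s \<le> v \<Longrightarrow> v \<le> t \<Longrightarrow> (F has_integral (x v - x s)) {s..v}"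
  shows "continuous_on {s..t} x"
proof (cases "s \<le> t")
  case True
  have "F integrable_on {s..t}"
    using assms[of t] True by (simp add: has_integral_integrable)
  then have "continuous_on {s..t} (\<lambda>v. x s + integral {s..v} F)"
    by (intro continuous_intros indefinite_integral_continuous_1)
  moreover have "x s + integral {s..v} F = x v" if "v \<in> {s..t}" for v
    using integral_unique[OF assms[of v]] that by simp
  ultimately show ?thesis
    by (rule continuous_on_eq)
qed auto

text \<open>The level set of \<open>m\<close> in \<open>{s..t}\<close> is compact, and nonempty by
  the intermediate value theorem; \<open>u\<close> is its greatest element. A value above
  \<open>m\<close> after \<open>u\<close> would force a later visit. This replaces sign arguments
  with derivatives, as the rate \<open>F\<close> is only integrable.\<close>

lemma last_visit:
  fixes x :: "real \<Rightarrow> real"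
  assumes "continuous_on {s..t} x" "s \<le> t" "m \<le> x s" "x t \<le> m"
  obtains u where "s \<le> u" "u \<le> t" "x u = m" "\<And>v. u \<le> v \<Longrightarrow> v \<le> t \<Longrightarrow> x v \<le> m"
proof -
  let ?S = "{v \<in> {s..t}. x v = m}"
  have "closed ?S"
    using continuous_closed_preimage_constant[OF assms(1)] by simp
  moreover have "bounded ?S"
    by (rule bounded_subset[of "{s..t}"]) auto
  ultimately have "compact ?S"
    by (simp add: compact_eq_bounded_closed)
  moreover have "?S \<noteq> {}"
    using IVT2'[of x t m s] assms by auto
  ultimately have "\<exists>u\<in>?S. \<forall>v\<in>?S. v \<le> u"
    by (rule compact_attains_sup)
  then obtain u where u: "u \<in> ?S" "\<forall>v\<in>?S. v \<le> u" ..
  have "x v \<le> m" if v: "u \<le> v" "v \<le> t" for v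
  proof (rule ccontr)
    assume "\<not> x v \<le> m"
    moreover have "continuous_on {v..t} x"
      using assms(1) u(1) v by (auto intro: continuous_on_subset)
    ultimately obtain w where "v \<le> w" "w \<le> t" "x w = m"
      using IVT2'[of x t m v] assms(4) v by auto
    then have "w = u"
      using u v by (auto intro: antisym)
    then show False
      using \<open>\<not> x v \<le> m\<close> \<open>v \<le> w\<close> v \<open>x w = m\<close> by auto
  qed
  then show thesis
    using that u(1) by auto
qed

text \<open>After its last visit to \<open>m\<close> the function stays in the region where
  \<open>- h\<close> bounds the rate from below, so it ends at most the integral of \<open>h\<close>
  below \<open>m\<close>. With \<open>h = 0\<close> the level cannot be crossed downwards; a nonzero
  \<open>h\<close> measures the loss under decay.\<close>

lemma lower_barrier:
  fixes x F h :: "real \<Rightarrow> real"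
  assumes inc: "\<And>u v. s \<le> u \<Longrightarrow> u \<le> v \<Longrightarrow> v \<le> t \<Longrightarrow> (F has_integral (x v - x u)) {u..v}"
    and "s \<le> t" "m \<le> x s"
    and h: "h integrable_on {s..t}" "\<And>v. s \<le> v \<Longrightarrow> v \<le> t \<Longrightarrow> 0 \<le> h v"
    and F: "\<And>v. s \<le> v \<Longrightarrow> v \<le> t \<Longrightarrow> x v \<le> m \<Longrightarrow> - h v \<le> F v"
  shows "m - integral {s..t} h \<le> x t"
proof (cases "x t \<le> m")
  case True
  have "continuous_on {s..t} x"
    by (rule continuous_on_if_has_integral_increments) (rule inc[OF order_refl])
  then obtain u where u: "s \<le> u" "u \<le> t" "x u = m" "\<And>v. u \<le> v \<Longrightarrow> v \<le> t \<Longrightarrow> x v \<le> m"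
    using \<open>s \<le> t\<close> \<open>m \<le> x s\<close> True by (rule last_visit) blast
  have hu: "h integrable_on {u..t}"
    using h(1) u by (auto intro: integrable_subinterval_real)
  \<comment> \<open>The time \<open>u\<close> is not known in advance; since \<open>h\<close> is
    nonnegative, the loss after \<open>u\<close> is at most the loss over the whole
    interval.\<close>
  have "integral {u..t} h \<le> integral {s..t} h"
    using h hu u by (intro integral_subset_le) auto
  moreover have "- integral {u..t} h \<le> x t - x u"
  proof (rule has_integral_le)
    show "((\<lambda>v. - h v) has_integral - integral {u..t} h) {u..t}"
      using has_integral_neg[OF integrable_integral[OF hu]] .
    show "(F has_integral (x t - x u)) {u..t}"
      using u by (intro inc) auto
  qed (use u F in auto)
  ultimately show ?thesis
    using u by simp
next
  case False
  then show ?thesis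
    using integral_nonneg[of h "{s..t}"] h by auto
qed

corollary lower_barrier_0:
  fixes x F :: "real \<Rightarrow> real"
  assumes "\<And>u v. s \<le> u \<Longrightarrow> u \<le> v \<Longrightarrow> v \<le> t \<Longrightarrow> (F has_integral (x v - x u)) {u..v}"
    and "s \<le> t" "m \<le> x s"
    and "\<And>v. s \<le> v \<Longrightarrow> v \<le> t \<Longrightarrow> x v \<le> m \<Longrightarrow> 0 \<le> F v"
  shows "m \<le> x t"
proof -
  have "m - integral {s..t} (\<lambda>_. 0) \<le> x t"
    by (rule lower_barrier) (use assms in \<open>simp_all add: integrable_0\<close>)
  then show ?thesis
    by simp
qed

corollary upper_barrier_0:
  fixes x F :: "real \<Rightarrow> real"
  assumes inc: "\<And>u v. s \<le> u \<Longrightarrow> u \<le> v \<Longrightarrow> v \<le> t \<Longrightarrow> (F has_integral (x v - x u)) {u..v}"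
    and "s \<le> t" "x s \<le> M"
    and "\<And>v. s \<le> v \<Longrightarrow> v \<le> t \<Longrightarrow> M \<le> x v \<Longrightarrow> F v \<le> 0"
  shows "x t \<le> M"
proof -
  have "((\<lambda>v. - F v) has_integral (- x v - (- x u))) {u..v}" if "s \<le> u" "u \<le> v" "v \<le> t" for u v
    using has_integral_neg[OF inc[OF that]] by simp
  then have "- M \<le> - x t"
    by (rule lower_barrier_0) (use assms in simp_all)
  then show ?thesis
    by simp
qed

text \<open>Barrier at the level \<open>x s\<close> with \<open>h v = x s * g v\<close>: where
  \<open>x v \<le> x s\<close>, the decay rate \<open>g v * x v\<close> is at most
  \<open>h v\<close>.\<close>

lemma linear_decay_bound:
  fixes x F g :: "real \<Rightarrow> real"
  assumes "\<And>u v. s \<le> u \<Longrightarrow> u \<le> v \<Longrightarrow> v \<le> t \<Longrightarrow> (F has_integral (x v - x u)) {u..v}"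
    and "s \<le> t" "0 \<le> x s"
    and "g integrable_on {s..t}" and g: "\<And>v. s \<le> v \<Longrightarrow> v \<le> t \<Longrightarrow> 0 \<le> g v"
    and F: "\<And>v. s \<le> v \<Longrightarrow> v \<le> t \<Longrightarrow> - g v * x v \<le> F v"
  shows "x s * (1 - integral {s..t} g) \<le> x t"
proof -
  have "(\<lambda>v. x s * g v) integrable_on {s..t}"
    using assms by (simp add: integrable_on_mult_right)
  moreover have "- (x s * g v) \<le> F v" if "s \<le> v" "v \<le> t" "x v \<le> x s" for v
    using g[of v] F[of v] mult_left_mono[of "x v" "x s" "g v"] that by (auto simp: mult.commute)
  ultimately have "x s - integral {s..t} (\<lambda>v. x s * g v) \<le> x t"
    by (intro lower_barrier[where F = F]) (use assms in simp_all)
  then show ?thesis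
    by (simp add: algebra_simps)
qed

text \<open>A power of \<open>2\<close> replaces \<open>exp (- integral {s..t} g)\<close>: halving over pieces of \<open>g\<close>-mass \<open>1/2\<close>
  avoids a product rule for absolutely continuous functions.\<close>

lemma exponential_decay_bound:
  fixes x F g :: "real \<Rightarrow> real"
  assumes "\<And>u v. s \<le> u \<Longrightarrow> u \<le> v \<Longrightarrow> v \<le> t \<Longrightarrow> (F has_integral (x v - x u)) {u..v}"
    and "s \<le> t" "0 < x s"
    and "g integrable_on {s..t}" "\<And>v. s \<le> v \<Longrightarrow> v \<le> t \<Longrightarrow> 0 \<le> g v"
    and "\<And>v. s \<le> v \<Longrightarrow> v \<le> t \<Longrightarrow> - g v * x v \<le> F v"
    and "integral {s..t} g \<le> real n / 2"
  shows "x s / 2 ^ n \<le> x t"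
  using assms
proof (induction n arbitrary: s)
  case 0
  have "0 \<le> integral {s..t} g"
    using 0 by (intro integral_nonneg) simp_all
  then have "integral {s..t} g = 0"
    using 0(7) by simp
  moreover have "x s * (1 - integral {s..t} g) \<le> x t"
    by (rule linear_decay_bound) (use 0 in simp_all)
  ultimately show ?case
    by simp
next
  case (Suc n)
  show ?case
  proof (cases "integral {s..t} g \<le> 1/2")
    case True
    have "x s / 2 ^ Suc n \<le> x s * (1 / 2)"
      using Suc.prems(3) by (simp add: field_simps)
    also have "\<dots> \<le> x s * (1 - integral {s..t} g)"
      using Suc.prems(3) True by (intro mult_left_mono) auto
    also have "\<dots> \<le> x t"
      by (rule linear_decay_bound) (use Suc.prems in simp_all)
    finally show ?thesis .
  next
    case False
    \<comment> \<open>A piece of mass exactly \<open>1/2\<close> is split off, which costs at most a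
      factor \<open>2\<close> by the linear bound; mass at most \<open>n / 2\<close> remains for the
      induction hypothesis.\<close>
    then obtain u where u: "s \<le> u" "u \<le> t" "integral {s..u} g = 1/2"
      using IVT'[of "\<lambda>u. integral {s..u} g" s "1/2" t] Suc.prems(2)
        indefinite_integral_continuous_1[OF Suc.prems(4)]
      by auto
    have "g integrable_on {s..u}"
      using Suc.prems(4) u by (auto intro: integrable_subinterval_real)
    then have "x s * (1 - integral {s..u} g) \<le> x u"
      by (intro linear_decay_bound[where F = F]) (use Suc.prems u in simp_all)
    then have xu: "x s / 2 \<le> x u"
      using u by simp
    have "integral {u..t} g \<le> real n / 2"
      using Henstock_Kurzweil_Integration.integral_combine[OF u(1,2) Suc.prems(4)] u(3) Suc.prems(7)
      by simp
    moreover have "g integrable_on {u..t}"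
      using Suc.prems(4) u by (auto intro: integrable_subinterval_real)
    ultimately have "x u / 2 ^ n \<le> x t"
      using xu by (intro Suc.IH) (use Suc.prems(1,3,5,6) u in simp_all)
    moreover have "x s / 2 ^ Suc n \<le> x u / 2 ^ n"
      using divide_right_mono[OF xu, of "2 ^ n"] by (simp add: field_simps)
    ultimately show ?thesis
      by linarith
  qed
qed

text \<open>The method of steps. The interval from \<open>T - \<tau>\<close> to \<open>T\<close>
  carries the history. In a step \<open>t \<le> s + \<tau>\<close>, so for every \<open>v\<close>
  between \<open>s\<close> and \<open>t\<close> the delayed time \<open>v - \<tau>\<close> lies
  where \<open>P\<close> is already known.\<close>

lemma delay_induct:
  fixes \<tau> T t :: real
  assumes "0 < \<tau>" "T - \<tau> \<le> t"
    and base: "\<And>t. T - \<tau> \<le> t \<Longrightarrow> t \<le> T \<Longrightarrow> P t"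
    and step: "\<And>s t. T \<le> s \<Longrightarrow> s \<le> t \<Longrightarrow> t \<le> s + \<tau> \<Longrightarrow>
      (\<And>v. T - \<tau> \<le> v \<Longrightarrow> v \<le> s \<Longrightarrow> P v) \<Longrightarrow> P t"
  shows "P t"
proof -
  have *: "\<forall>t. T - \<tau> \<le> t \<and> t \<le> T + real n * \<tau> \<longrightarrow> P t" for n
  proof (induction n)
    case (Suc n)
    show ?case
    proof (intro allI impI)
      fix t assume t: "T - \<tau> \<le> t \<and> t \<le> T + real (Suc n) * \<tau>"
      show "P t"
      proof (cases "t \<le> T + real n * \<tau>")
        case False
        show ?thesis
        proof (rule step[of "T + real n * \<tau>"])
          show "t \<le> T + real n * \<tau> + \<tau>"
            using t by (simp add: algebra_simps)
        qed (use False Suc.IH \<open>0 < \<tau>\<close> in simp_all)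
      qed (use Suc.IH t in auto)
    qed
  qed (use base in auto)
  obtain n :: nat where "t - T \<le> real n * \<tau>"
    using reals_Archimedean3[OF \<open>0 < \<tau>\<close>] by (meson less_eq_real_def)
  then show ?thesis
    using *[of n] assms(2) by auto
qed

section \<open>Bounds on the Mackey--Glass nonlinearity\<close>

text \<open>Compare \<open>y\<close> with \<open>1\<close> if \<open>y \<le> 1\<close>, and with
  \<open>y powr p\<close> otherwise. The production term is thus at most \<open>r\<close>, which
  yields upper bounds on solutions.\<close>

lemma MG_feedback_le_1:
  fixes p y :: real
  assumes "1 \<le> p" "0 < y"
  shows "y / (1 + y powr p) \<le> 1"
proof -
  have "y \<le> 1 + y powr p"
  proof (cases "y \<le> 1")
    case False
    then show ?thesis
      using powr_mono[of 1 p y] assms by simp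
  qed (simp add: add_increasing2)
  then show ?thesis
    by (simp add: add_pos_nonneg divide_le_eq_1)
qed

text \<open>The hypothesis says that the denominator is at most \<open>\<rho>\<close>, that is, that
  \<open>y\<close> does not exceed the positive fixed point of the nonlinearity scaled by
  \<open>\<rho>\<close>.\<close>

lemma MG_feedback_expanding:
  fixes p y \<rho> :: real
  assumes "0 < y" "y powr p \<le> \<rho> - 1"
  shows "y \<le> \<rho> * (y / (1 + y powr p))"
proof -
  have "y * (1 + y powr p) \<le> y * \<rho>"
    using assms by (intro mult_left_mono) auto
  then show ?thesis
    by (simp add: add_pos_nonneg pos_le_divide_eq mult.commute)
qed

section \<open>Positivity and persistence of solutions\<close>

text \<open>Passes from Lebesgue integrals starting at \<open>0\<close> to gauge integrals over
  arbitrary windows, the form in which the barrier lemmas take their input.\<close>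

lemma MG_solution_has_integral:
  assumes sol: "MG_solution \<tau> p \<gamma> r \<phi> x" and "0 \<le> u" "u \<le> v"
  shows "(MG_rhs \<tau> p \<gamma> r x has_integral (x v - x u)) {u..v}"
proof -
  let ?F = "MG_rhs \<tau> p \<gamma> r x"
  have F: "?F integrable_on {0..t}" "x t = \<phi> 0 + integral {0..t} ?F" if "0 \<le> t" for t
  proof -
    have "integrable (lebesgue_on {0..t}) ?F" "x t = \<phi> 0 + integral\<^sup>L (lebesgue_on {0..t}) ?F"
      using sol that by (auto simp: MG_solution_def)
    then show "?F integrable_on {0..t}" "x t = \<phi> 0 + integral {0..t} ?F"
      by (simp_all add: integrable_on_lebesgue_on lebesgue_integral_eq_integral)
  qed
  have "integral {0..u} ?F + integral {u..v} ?F = integral {0..v} ?F"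
    using assms F(1)[of v] by (intro Henstock_Kurzweil_Integration.integral_combine) auto
  then have "integral {u..v} ?F = x v - x u"
    using F(2)[of u] F(2)[of v] assms by simp
  moreover have "?F integrable_on {u..v}"
    using F(1)[of v] assms by (auto intro: integrable_subinterval_real)
  ultimately show ?thesis
    using integrable_integral by metis
qed

lemma MG_rhs_ge_decay:
  assumes "0 \<le> r t" "0 \<le> x (t - \<tau>)"
  shows "- \<gamma> t * x t \<le> MG_rhs \<tau> p \<gamma> r x t"
  using assms by (auto simp: MG_rhs_def)

text \<open>While the delayed values are positive, production is nonnegative and \<open>x\<close>
  decays at rate at most \<open>\<gamma>\<close>. Local integrability of \<open>\<gamma>\<close>
  keeps the loss over a delay interval to a finite factor.\<close>

lemma MG_solution_pos:
  assumes sol: "MG_solution \<tau> p \<gamma> r \<phi> x" and "0 < \<tau>"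
    and \<gamma>: "\<And>T. \<gamma> integrable_on {0..T}" "\<And>t. 0 \<le> t \<Longrightarrow> 0 \<le> \<gamma> t"
    and r: "\<And>t. 0 \<le> t \<Longrightarrow> 0 \<le> r t"
    and \<phi>: "\<And>t. - \<tau> \<le> t \<Longrightarrow> t \<le> 0 \<Longrightarrow> 0 < \<phi> t"
    and "- \<tau> \<le> t"
  shows "0 < x t"
proof (rule delay_induct[where \<tau> = \<tau> and T = 0 and P = "\<lambda>t. 0 < x t"])
  show "0 < x t" if "0 - \<tau> \<le> t" "t \<le> 0" for t
    using sol \<phi>[of t] that by (auto simp: MG_solution_def)
  show "0 < x t"
    if s: "0 \<le> s" "s \<le> t" "t \<le> s + \<tau>" and IH: "\<And>v. 0 - \<tau> \<le> v \<Longrightarrow> v \<le> s \<Longrightarrow> 0 < x v" for s t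
  proof -
    obtain n :: nat where n: "2 * integral {s..t} \<gamma> \<le> real n"
      using real_arch_simple by blast
    have "x s / 2 ^ n \<le> x t"
    proof (rule exponential_decay_bound[where F = "MG_rhs \<tau> p \<gamma> r x" and x = x and g = \<gamma>])
      show "(MG_rhs \<tau> p \<gamma> r x has_integral x v - x u) {u..v}" if "s \<le> u" "u \<le> v" "v \<le> t" for u v
        using MG_solution_has_integral[OF sol] that s by simp
      show "\<gamma> integrable_on {s..t}"
        using \<gamma>(1)[of t] s by (auto intro: integrable_subinterval_real)
      show "- \<gamma> v * x v \<le> MG_rhs \<tau> p \<gamma> r x v" if "s \<le> v" "v \<le> t" for v
        using r[of v] IH[of "v - \<tau>"] that s by (intro MG_rhs_ge_decay) auto
    qed (use s IH \<open>0 < \<tau>\<close> n \<gamma> in auto)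
    moreover have "0 < x s / 2 ^ n"
      using IH[of s] s \<open>0 < \<tau>\<close> by simp
    ultimately show ?thesis
      by linarith
  qed
qed (use assms in auto)

text \<open>Where \<open>x \<le> m\<close>, the feedback condition makes production outweigh decay,
  so \<open>m\<close> is a lower barrier on each delay interval. That condition is required only
  when \<open>x t \<le> m\<close>, so that a small present value may be used to bound the delayed
  one from above.\<close>

lemma MG_solution_lower_bound:
  assumes sol: "MG_solution \<tau> p \<gamma> r \<phi> x" and "0 < \<tau>" "0 \<le> T" "0 < m" "0 \<le> \<rho>"
    and \<gamma>: "\<And>t. T \<le> t \<Longrightarrow> 0 \<le> \<gamma> t"
    and r: "\<And>t. T \<le> t \<Longrightarrow> \<rho> * \<gamma> t \<le> r t"
    and init: "\<And>t. T - \<tau> \<le> t \<Longrightarrow> t \<le> T \<Longrightarrow> m \<le> x t"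
    and feedback: "\<And>t. T \<le> t \<Longrightarrow> x t \<le> m \<Longrightarrow> m \<le> x (t - \<tau>) \<Longrightarrow>
      m \<le> \<rho> * (x (t - \<tau>) / (1 + x (t - \<tau>) powr p))"
    and "T - \<tau> \<le> t"
  shows "m \<le> x t"
proof (rule delay_induct[where \<tau> = \<tau> and T = T and P = "\<lambda>t. m \<le> x t"])
  show "m \<le> x t"
    if s: "T \<le> s" "s \<le> t" "t \<le> s + \<tau>" and IH: "\<And>v. T - \<tau> \<le> v \<Longrightarrow> v \<le> s \<Longrightarrow> m \<le> x v" for s t
  proof (rule lower_barrier_0[where F = "MG_rhs \<tau> p \<gamma> r x" and x = x])
    show "(MG_rhs \<tau> p \<gamma> r x has_integral x v - x u) {u..v}" if "s \<le> u" "u \<le> v" "v \<le> t" for u v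
      using MG_solution_has_integral[OF sol] that s \<open>0 \<le> T\<close> by simp
    show "0 \<le> MG_rhs \<tau> p \<gamma> r x v" if v: "s \<le> v" "v \<le> t" "x v \<le> m" for v
    proof -
      let ?f = "x (v - \<tau>) / (1 + x (v - \<tau>) powr p)"
      have delayed: "m \<le> x (v - \<tau>)"
        using IH v s by simp
      then have "0 \<le> ?f"
        using \<open>0 < m\<close> by simp
      have "\<gamma> v * x v \<le> \<gamma> v * m"
        using \<gamma>[of v] v s by (intro mult_left_mono) auto
      also have "\<dots> \<le> \<gamma> v * (\<rho> * ?f)"
        using \<gamma>[of v] feedback[of v] delayed v s by (intro mult_left_mono) auto
      also have "\<dots> \<le> r v * ?f"
        using mult_right_mono[OF r[of v] \<open>0 \<le> ?f\<close>] v s by (simp add: mult_ac)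
      finally show ?thesis
        by (simp add: MG_rhs_def)
    qed
  qed (use s IH \<open>0 < \<tau>\<close> in auto)
qed (use assms in auto)

text \<open>On \<open>{0..T}\<close> a positive minimum exists by compactness. As
  \<open>\<tau> \<le> T\<close>, this interval contains the history window of \<open>T\<close>, from
  which a level \<open>m\<close> is propagated; each alternative in \<open>bound\<close> supplies
  such a level.\<close>

lemma MG_persistence:
  assumes sol: "MG_solution \<tau> p \<gamma> r \<phi> x" and "0 < \<tau>" "1 \<le> p"
    and \<gamma>: "\<And>T. \<gamma> integrable_on {0..T}" "\<And>t. 0 \<le> t \<Longrightarrow> 0 \<le> \<gamma> t"
    and r: "\<And>t. 0 \<le> t \<Longrightarrow> 0 \<le> r t"
    and \<phi>: "\<And>t. - \<tau> \<le> t \<Longrightarrow> t \<le> 0 \<Longrightarrow> 0 < \<phi> t"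
    and \<rho>: "1 < \<rho>" "\<And>t. T \<le> t \<Longrightarrow> \<rho> * \<gamma> t \<le> r t"
    and T: "\<tau> \<le> T"
    and bound: "(\<exists>K. \<forall>t\<ge>T. r t \<le> K * \<gamma> t) \<or> (\<exists>B. \<forall>t\<ge>0. integral {t..t + \<tau>} \<gamma> \<le> B)"
  shows "\<exists>m>0. \<forall>t\<ge>0. m \<le> x t"
proof -
  have pos: "0 < x t" if "- \<tau> \<le> t" for t
    by (rule MG_solution_pos[OF sol \<open>0 < \<tau>\<close>]) (use \<gamma> r \<phi> that in simp_all)
  have inc: "(MG_rhs \<tau> p \<gamma> r x has_integral x v - x u) {u..v}" if "0 \<le> u" "u \<le> v" for u v
    using MG_solution_has_integral[OF sol that] .
  have cont: "continuous_on {0..T} x"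
    by (rule continuous_on_if_has_integral_increments) (rule inc[OF order_refl])
  have "0 < T"
    using T \<open>0 < \<tau>\<close> by simp
  obtain t0 where "t0 \<in> {0..T}" and m0: "\<And>t. t \<in> {0..T} \<Longrightarrow> x t0 \<le> x t"
    using continuous_attains_inf[OF _ _ cont] \<open>0 < T\<close> by auto
  obtain t1 where "t1 \<in> {0..T}" and M0: "\<And>t. t \<in> {0..T} \<Longrightarrow> x t \<le> x t1"
    using continuous_attains_sup[OF _ _ cont] \<open>0 < T\<close> by auto
  \<comment> \<open>The positive fixed point of \<open>\<rho> * (y / (1 + y powr p))\<close>; up to
    \<open>\<delta>\<close> this map does not decrease its argument.\<close>
  define \<delta> where "\<delta> = (\<rho> - 1) powr (1 / p)"
  have \<delta>: "0 < \<delta>" "\<delta> powr p = \<rho> - 1"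
    using \<rho> \<open>1 \<le> p\<close> by (auto simp: \<delta>_def powr_powr)
  have expanding: "y \<le> \<rho> * (y / (1 + y powr p))" if "0 < y" "y \<le> \<delta>" for y
    using powr_mono2[of p y \<delta>] that \<delta> \<open>1 \<le> p\<close> by (intro MG_feedback_expanding) auto
  obtain m where m: "0 < m" "m \<le> x t0" and feedback: "\<And>t. T \<le> t \<Longrightarrow> x t \<le> m \<Longrightarrow> m \<le> x (t - \<tau>) \<Longrightarrow>
      m \<le> \<rho> * (x (t - \<tau>) / (1 + x (t - \<tau>) powr p))"
    using bound
  proof (elim disjE exE)
    fix K assume K: "\<forall>t\<ge>T. r t \<le> K * \<gamma> t"
    \<comment> \<open>\<open>x t1\<close> bounds \<open>x\<close> up to \<open>T\<close>. Beyond
      \<open>T\<close>, production is at most \<open>K * \<gamma>\<close>, so the rate is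
      nonpositive wherever \<open>x\<close> is at least \<open>K\<close>.\<close>
    define M where "M = max (x t1) K"
    have M: "x t \<le> M" if "0 \<le> t" for t
    proof (cases "t \<le> T")
      case True
      then show ?thesis
        using M0 that by (auto simp: M_def intro: le_max_iff_disj[THEN iffD2])
    next
      case False
      have "MG_rhs \<tau> p \<gamma> r x v \<le> 0" if v: "T \<le> v" "M \<le> x v" for v
      proof -
        have "r v * (x (v - \<tau>) / (1 + x (v - \<tau>) powr p)) \<le> r v * 1"
          using r[of v] pos[of "v - \<tau>"] v T \<open>0 < \<tau>\<close> \<open>1 \<le> p\<close>
          by (intro mult_left_mono MG_feedback_le_1) auto
        also have "\<dots> \<le> \<gamma> v * K"
          using K v by (simp add: mult.commute)
        also have "\<dots> \<le> \<gamma> v * x v"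
          using \<gamma>(2)[of v] v \<open>0 < T\<close> by (intro mult_left_mono) (auto simp: M_def)
        finally show ?thesis
          by (simp add: MG_rhs_def)
      qed
      moreover have "x T \<le> M"
        using M0[of T] \<open>0 < T\<close> by (simp add: M_def)
      ultimately show ?thesis
        by (intro upper_barrier_0[of T t "MG_rhs \<tau> p \<gamma> r x" x M]) (use inc False \<open>0 < T\<close> in simp_all)
    qed
    \<comment> \<open>A lower bound for the scaled feedback on delayed values between
      \<open>\<delta>\<close> and \<open>M\<close>: least numerator over greatest
      denominator.\<close>
    let ?c = "\<rho> * (\<delta> / (1 + M powr p))"
    have "0 < ?c"
      using \<rho> \<delta> by (simp add: add_pos_nonneg)
    show thesis
    proof (rule that[of "min (x t0) ?c"])
      show "0 < min (x t0) ?c"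
        using \<open>0 < ?c\<close> pos[of t0] \<open>t0 \<in> {0..T}\<close> \<open>0 < \<tau>\<close> by simp
      fix t assume t: "T \<le> t" "min (x t0) ?c \<le> x (t - \<tau>)"
      define y where "y = x (t - \<tau>)"
      have y: "0 < y" "y \<le> M"
        using pos[of "t - \<tau>"] M[of "t - \<tau>"] t T \<open>0 < \<tau>\<close> by (auto simp: y_def)
      have "min (x t0) ?c \<le> \<rho> * (y / (1 + y powr p))"
      proof (cases "y \<le> \<delta>")
        case True
        then show ?thesis
          using expanding[of y] y t(2) unfolding y_def[symmetric] by linarith
      next
        case False
        have "?c \<le> \<rho> * (y / (1 + y powr p))"
          using False y \<delta> \<rho> powr_mono2[of p y M] \<open>1 \<le> p\<close>
          by (intro mult_left_mono frac_le) (auto simp: add_pos_nonneg)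
        then show ?thesis
          by linarith
      qed
      then show "min (x t0) ?c \<le> \<rho> * (x (t - \<tau>) / (1 + x (t - \<tau>) powr p))"
        by (simp add: y_def)
    qed simp
  next
    fix B assume B: "\<forall>t\<ge>0. integral {t..t + \<tau>} \<gamma> \<le> B"
    \<comment> \<open>Every window of length \<open>\<tau>\<close> has mass at most
      \<open>n / 2\<close>, so \<open>n\<close> halvings suffice uniformly in time.\<close>
    obtain n :: nat where n: "2 * B \<le> real n"
      using real_arch_simple by blast
    have decay: "x (t - \<tau>) / 2 ^ n \<le> x t" if t: "T \<le> t" for t
    proof (rule exponential_decay_bound[where F = "MG_rhs \<tau> p \<gamma> r x" and x = x and g = \<gamma>])
      show "(MG_rhs \<tau> p \<gamma> r x has_integral x v - x u) {u..v}"
        if "t - \<tau> \<le> u" "u \<le> v" "v \<le> t" for u v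
        using inc that t T by simp
      show "\<gamma> integrable_on {t - \<tau>..t}"
        using \<gamma>(1)[of t] t T by (auto intro: integrable_subinterval_real)
      show "- \<gamma> v * x v \<le> MG_rhs \<tau> p \<gamma> r x v" if "t - \<tau> \<le> v" "v \<le> t" for v
        using r[of v] pos[of "v - \<tau>"] that t T by (intro MG_rhs_ge_decay) auto
      show "integral {t - \<tau>..t} \<gamma> \<le> real n / 2"
        using B[rule_format, of "t - \<tau>"] n t T by simp
    qed (use t T \<open>0 < \<tau>\<close> pos \<gamma> in auto)
    show thesis
    \<comment> \<open>By \<open>decay\<close>, a value \<open>x t\<close> of at most
      \<open>\<delta> / 2 ^ n\<close> forces the delayed value to be at most
      \<open>\<delta>\<close>, where the feedback is expanding.\<close>
    proof (rule that[of "min (x t0) (\<delta> / 2 ^ n)"])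
      show "0 < min (x t0) (\<delta> / 2 ^ n)"
        using \<delta> pos[of t0] \<open>t0 \<in> {0..T}\<close> \<open>0 < \<tau>\<close> by simp
      fix t assume t: "T \<le> t" "x t \<le> min (x t0) (\<delta> / 2 ^ n)" "min (x t0) (\<delta> / 2 ^ n) \<le> x (t - \<tau>)"
      have "x (t - \<tau>) / 2 ^ n \<le> \<delta> / 2 ^ n"
        using decay[OF t(1)] t(2) by linarith
      then have "x (t - \<tau>) \<le> \<delta>"
        by (simp add: divide_le_cancel)
      then show "min (x t0) (\<delta> / 2 ^ n) \<le> \<rho> * (x (t - \<tau>) / (1 + x (t - \<tau>) powr p))"
        using expanding[of "x (t - \<tau>)"] pos[of "t - \<tau>"] t(1,3) T \<open>0 < \<tau>\<close> by linarith
    qed simp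
  qed
  have "m \<le> x t" if "0 \<le> t" for t
  proof (cases "t \<le> T")
    case True
    then show ?thesis
      using m(2) m0[of t] that by simp
  next
    case False
    show ?thesis
    proof (rule MG_solution_lower_bound[OF sol \<open>0 < \<tau>\<close>, of T m \<rho>])
      show "m \<le> x t" if "T - \<tau> \<le> t" "t \<le> T" for t
        using m(2) m0[of t] T that by simp
    qed (use m \<rho> \<gamma>(2) feedback False \<open>0 < T\<close> \<open>0 < \<tau>\<close> in auto)
  qed
  then show ?thesis
    using m(1) by blast
qed

section \<open>The constant solution and its uniqueness\<close>

text \<open>The second hypothesis is the equilibrium equation divided by \<open>c\<close>, so the
  right-hand side vanishes identically.\<close>

lemma MG_solution_equilibrium:
  assumes "0 < \<tau>" "k / (1 + c powr p) = g"
  shows "MG_solution \<tau> p (\<lambda>_. g) (\<lambda>_. k) (\<lambda>\<theta>\<in>{- \<tau>..0}. c) (\<lambda>_. c)"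
proof -
  have "MG_rhs \<tau> p (\<lambda>_. g) (\<lambda>_. k) (\<lambda>_. c) = (\<lambda>_. 0)"
    using assms by (auto simp: MG_rhs_def)
  then show ?thesis
    using \<open>0 < \<tau>\<close> by (simp add: MG_solution_def)
qed

text \<open>Once the delayed value is \<open>c\<close>, the right-hand side reduces to
  \<open>g * (c - x v)\<close>. Hence \<open>c\<close> is both a lower and an upper barrier on the
  next delay interval.\<close>

lemma MG_solution_equilibrium_unique:
  assumes sol: "MG_solution \<tau> p (\<lambda>_. g) (\<lambda>_. k) \<phi> x" and "0 < \<tau>" "0 \<le> g"
    and c: "k / (1 + c powr p) = g"
    and \<phi>: "\<And>t. - \<tau> \<le> t \<Longrightarrow> t \<le> 0 \<Longrightarrow> \<phi> t = c"
    and "- \<tau> \<le> t"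
  shows "x t = c"
proof (rule delay_induct[where \<tau> = \<tau> and T = 0 and P = "\<lambda>t. x t = c"])
  show "x t = c" if "0 - \<tau> \<le> t" "t \<le> 0" for t
    using sol \<phi>[of t] that by (auto simp: MG_solution_def)
  show "x t = c"
    if s: "0 \<le> s" "s \<le> t" "t \<le> s + \<tau>" and IH: "\<And>v. 0 - \<tau> \<le> v \<Longrightarrow> v \<le> s \<Longrightarrow> x v = c" for s t
  proof -
    let ?F = "MG_rhs \<tau> p (\<lambda>_. g) (\<lambda>_. k) x"
    have inc: "(?F has_integral x v - x u) {u..v}" if "s \<le> u" "u \<le> v" for u v
      using MG_solution_has_integral[OF sol] that s by simp
    have F: "?F v = g * (c - x v)" if "s \<le> v" "v \<le> t" for v
      using IH[of "v - \<tau>"] that s c by (auto simp: MG_rhs_def algebra_simps)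
    have "x s = c"
      using IH s \<open>0 < \<tau>\<close> by simp
    then have "c \<le> x t"
      by (intro lower_barrier_0[of s t ?F x c]) (use inc s F \<open>0 \<le> g\<close> in simp_all)
    moreover have "x t \<le> c"
      using \<open>x s = c\<close>
      by (intro upper_barrier_0[of s t ?F x c])
        (use inc s F \<open>0 \<le> g\<close> in \<open>simp_all add: mult_nonneg_nonpos\<close>)
    ultimately show ?thesis
      by simp
  qed
qed (use assms in auto)

section \<open>Borel sets of the space of segments\<close>

lemma open_sets_C_space: "{U. openin (mtopology_of (C_space \<tau>)) U} \<subseteq> Pow (mspace (C_space \<tau>))"
  using openin_subset[of "mtopology_of (C_space \<tau>)"] by auto

lemma space_C_borel: "space (C_borel \<tau>) = mspace (C_space \<tau>)"
  unfolding C_borel_def by (rule space_measure_of[OF open_sets_C_space])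

lemma openin_in_sets_C_borel:
  assumes "openin (mtopology_of (C_space \<tau>)) U"
  shows "U \<in> sets (C_borel \<tau>)"
  using assms unfolding C_borel_def sets_measure_of[OF open_sets_C_space] by auto

lemma const_in_C_borel: "(\<lambda>\<theta>\<in>{-\<tau>..0}. c) \<in> space (C_borel \<tau>)"
proof -
  have "(\<lambda>\<theta>\<in>{-\<tau>..0}. c) ` {-\<tau>..0} \<subseteq> {c}"
    by auto
  then have "bounded ((\<lambda>\<theta>\<in>{-\<tau>..0}. c) ` {-\<tau>..0})"
    by (rule bounded_subset[rotated]) simp
  moreover have "continuous_on {-\<tau>..0} (\<lambda>\<theta>\<in>{-\<tau>..0}. c)"
    by (rule continuous_on_eq[OF continuous_on_const]) simp
  ultimately show ?thesis
    by (simp add: space_C_borel C_space_def)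
qed

text \<open>Points are closed in a metric space. Measurability of a point allows a Dirac law to be
  read as an almost sure identity.\<close>

lemma singleton_in_sets_C_borel:
  assumes "f \<in> space (C_borel \<tau>)"
  shows "{f} \<in> sets (C_borel \<tau>)"
proof -
  have "Hausdorff_space (mtopology_of (C_space \<tau>))"
    by (simp add: mtopology_of_def Metric_space.Hausdorff_space_mtopology)
  then have "closedin (mtopology_of (C_space \<tau>)) {f}"
    using assms by (simp add: closedin_Hausdorff_singleton space_C_borel)
  then have "mspace (C_space \<tau>) - {f} \<in> sets (C_borel \<tau>)"
    by (intro openin_in_sets_C_borel) (auto simp: closedin_def)
  then have "space (C_borel \<tau>) - (mspace (C_space \<tau>) - {f}) \<in> sets (C_borel \<tau>)"
    by (rule sets.compl_sets)
  moreover have "space (C_borel \<tau>) - (mspace (C_space \<tau>) - {f}) = {f}"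
    using assms by (auto simp: space_C_borel)
  ultimately show ?thesis
    by simp
qed

text \<open>Evaluation at a point is \<open>1\<close>-Lipschitz for the supremum metric, hence
  continuous.\<close>

lemma eval_measurable_C_borel:
  assumes "\<theta> \<in> {-\<tau>..0}"
  shows "(\<lambda>f. f \<theta>) \<in> borel_measurable (C_borel \<tau>)"
proof (rule borel_measurableI)
  have "Lipschitz_continuous_map (C_space \<tau>) euclidean_metric (\<lambda>f. f \<theta>)"
    unfolding Lipschitz_continuous_map_def
  proof (intro conjI exI ballI)
    fix f g assume "f \<in> mspace (C_space \<tau>)" "g \<in> mspace (C_space \<tau>)"
    then show "mdist euclidean_metric (f \<theta>) (g \<theta>) \<le> 1 * mdist (C_space \<tau>) f g"
      using mdist_cfunspace_imp_mdist_le[OF _ _ order_refl, of f "top_of_set {-\<tau>..0}" euclidean_metric g \<theta>]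
        assms unfolding C_space_def by simp
  qed simp
  then have cont: "continuous_map (mtopology_of (C_space \<tau>)) euclidean (\<lambda>f. f \<theta>)"
    using Lipschitz_continuous_imp_continuous_map by fastforce
  fix S :: "real set" assume "open S"
  then have "openin (mtopology_of (C_space \<tau>)) {f \<in> mspace (C_space \<tau>). f \<theta> \<in> S}"
    using openin_continuous_map_preimage[OF cont] by simp
  then have "{f \<in> mspace (C_space \<tau>). f \<theta> \<in> S} \<in> sets (C_borel \<tau>)"
    by (rule openin_in_sets_C_borel)
  also have "{f \<in> mspace (C_space \<tau>). f \<theta> \<in> S} = (\<lambda>f. f \<theta>) -` S \<inter> space (C_borel \<tau>)"
    by (auto simp: space_C_borel)
  finally show "(\<lambda>f. f \<theta>) -` S \<inter> space (C_borel \<tau>) \<in> sets (C_borel \<tau>)" .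
qed

section \<open>Invariance of the Dirac measure at the equilibrium\<close>

lemma MG_process_equilibrium:
  assumes "0 < \<tau>" "k / (1 + c powr p) = g"
  shows "MG_process \<tau> p g k (return (C_borel \<tau>) (\<lambda>\<theta>\<in>{-\<tau>..0}. c)) (\<lambda>_ _. c)"
  using MG_solution_equilibrium[OF assms] const_in_C_borel[of c \<tau>]
  by (simp add: MG_process_def segment_def prob_space_return)

text \<open>A process with this initial law starts almost surely in the constant segment. By
  uniqueness its paths are then almost surely constant, so all its segments have the same law. The
  deterministic process witnesses existence.\<close>

lemma MG_invariant_equilibrium:
  assumes "0 < \<tau>" "0 \<le> g" "k / (1 + c powr p) = g"
  shows "MG_invariant \<tau> p g k (return (C_borel \<tau>) (\<lambda>\<theta>\<in>{-\<tau>..0}. c))"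
    (is "MG_invariant _ _ _ _ ?\<nu>")
proof -
  let ?c = "\<lambda>\<theta>\<in>{-\<tau>..0}. c"
  have c: "?c \<in> space (C_borel \<tau>)"
    by (rule const_in_C_borel)
  have prob: "prob_space ?\<nu>"
    using c by (rule prob_space_return)
  have start: "distr ?\<nu> (C_borel \<tau>) (\<lambda>\<omega>. segment \<tau> (\<lambda>_. c) 0) = ?\<nu>"
    using prob_space.distr_const[OF prob c] by (simp add: segment_def)
  have "distr P (C_borel \<tau>) (\<lambda>\<omega>. segment \<tau> (X \<omega>) t) = ?\<nu>"
    if X: "MG_process \<tau> p g k P X" and init: "distr P (C_borel \<tau>) (\<lambda>\<omega>. segment \<tau> (X \<omega>) 0) = ?\<nu>"
      and "0 \<le> t" for P X t
  proof -
    have meas: "(\<lambda>\<omega>. segment \<tau> (X \<omega>) s) \<in> P \<rightarrow>\<^sub>M C_borel \<tau>" if "0 \<le> s" for s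
      using X that by (simp add: MG_process_def)
    \<comment> \<open>Equality with \<open>?c\<close> must be a measurable event before the almost
      sure identity can be pulled back along the initial segment.\<close>
    have "{f \<in> space (C_borel \<tau>). f = ?c} = {?c}"
      using c by blast
    then have sing: "{f \<in> space (C_borel \<tau>). f = ?c} \<in> sets (C_borel \<tau>)"
      using singleton_in_sets_C_borel[OF c] by (simp only:)
    have "AE f in ?\<nu>. f = ?c"
      using c sing by (subst AE_return) (auto simp: pred_def)
    then have "AE \<omega> in P. segment \<tau> (X \<omega>) 0 = ?c"
      using AE_distr_iff[OF meas[OF order_refl] sing] unfolding init by (rule iffD1[rotated])
    moreover have "AE \<omega> in P. MG_solution \<tau> p (\<lambda>_. g) (\<lambda>_. k) (segment \<tau> (X \<omega>) 0) (X \<omega>)"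
      using X by (simp add: MG_process_def)
    ultimately have "AE \<omega> in P. segment \<tau> (X \<omega>) t = ?c"
    proof eventually_elim
      case (elim \<omega>)
      have "X \<omega> s = c" if "- \<tau> \<le> s" for s
        using that elim by (intro MG_solution_equilibrium_unique[OF elim(2) assms]) simp_all
      then show ?case
        using \<open>0 \<le> t\<close> by (auto simp: segment_def restrict_def)
    qed
    then have "distr P (C_borel \<tau>) (\<lambda>\<omega>. segment \<tau> (X \<omega>) t) = distr P (C_borel \<tau>) (\<lambda>_. ?c)"
      using meas[OF \<open>0 \<le> t\<close>] c by (intro distr_cong_AE) simp_all
    also have "\<dots> = ?\<nu>"
      using X c by (intro prob_space.distr_const) (simp_all add: MG_process_def)
    finally show ?thesis .
  qed
  moreover have "\<exists>P X. MG_process \<tau> p g k P X \<and>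
      distr P (C_borel \<tau>) (\<lambda>\<omega>. segment \<tau> (X \<omega>) 0) = ?\<nu>"
    using MG_process_equilibrium[OF assms(1,3)] start by blast
  ultimately show ?thesis
    using prob unfolding MG_invariant_def by simp
qed

lemma MG_stationary_equilibrium:
  assumes "0 < \<tau>" "k / (1 + c powr p) = g"
  shows "MG_stationary \<tau> p g k (return borel c)"
proof -
  let ?P = "return (C_borel \<tau>) (\<lambda>\<theta>\<in>{-\<tau>..0}. c)"
  have "prob_space ?P"
    by (rule prob_space_return[OF const_in_C_borel])
  then have "distr ?P borel (\<lambda>_. c) = return borel c"
    by (rule prob_space.distr_const) simp
  then show ?thesis
    unfolding MG_stationary_def using MG_process_equilibrium[OF assms]
    by (auto simp: prob_space_return)
qed

section \<open>Translation of the limit conditions and choice of the equilibrium\<close>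

theorem corollary2p1:
  fixes \<tau> p :: real and \<gamma> r :: "real \<Rightarrow> real"
  assumes "\<tau> > 0"
    and "\<gamma> \<in> borel_measurable (lebesgue_on {0..})"
    and "r \<in> borel_measurable (lebesgue_on {0..})"
    and "\<forall>t\<ge>0. \<gamma> t > 0"
    and "\<forall>t\<ge>0. r t > 0"
    and "p > 1"
    and "Liminf at_top (\<lambda>t. ereal (r t / \<gamma> t)) > 1"
  shows
    "((\<forall>T\<ge>0. integrable (lebesgue_on {0..T}) \<gamma>) \<and>
      (Limsup at_top (\<lambda>t. ereal (r t / \<gamma> t)) < \<infinity> \<or>
       (\<exists>B. \<forall>t\<ge>0. integral\<^sup>L (lebesgue_on {t..t + \<tau>}) \<gamma> \<le> B)) \<longrightarrow>
      (\<forall>\<phi> x. cadlag_on (- \<tau>) 0 \<phi> \<and> (INF t\<in>{-\<tau>..0}. ereal (\<phi> t)) > 0 \<and>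
             MG_solution \<tau> p \<gamma> r \<phi> x \<longrightarrow>
         (INF t\<in>{0..}. ereal (x t)) > 0)) \<and>
     (\<forall>g k. (\<forall>t\<ge>0. \<gamma> t = g \<and> r t = k) \<longrightarrow>
        k > g \<and>
        (\<exists>\<nu>. MG_invariant \<tau> p g k \<nu> \<and>
             \<nu> \<noteq> return (C_borel \<tau>) (\<lambda>\<theta>\<in>{-\<tau>..0}. 0) \<and>
             (let \<mu> = distr \<nu> borel (\<lambda>\<phi>. \<phi> 0) in
                MG_stationary \<tau> p g k \<mu> \<and>
                (\<exists>m M. m > 0 \<and> M > 0 \<and> measure \<mu> {m..M} = 1))))"
proof (intro conjI impI allI)
  fix \<phi> x
  assume rates: "(\<forall>T\<ge>0. integrable (lebesgue_on {0..T}) \<gamma>) \<and>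
      (Limsup at_top (\<lambda>t. ereal (r t / \<gamma> t)) < \<infinity> \<or>
       (\<exists>B. \<forall>t\<ge>0. integral\<^sup>L (lebesgue_on {t..t + \<tau>}) \<gamma> \<le> B))"
    and x: "cadlag_on (- \<tau>) 0 \<phi> \<and> (INF t\<in>{-\<tau>..0}. ereal (\<phi> t)) > 0 \<and>
             MG_solution \<tau> p \<gamma> r \<phi> x"
  \<comment> \<open>A real number strictly below the limit inferior, which may be infinite; the
    quotient eventually exceeds it.\<close>
  obtain \<rho> where \<rho>: "1 < \<rho>" "ereal \<rho> < Liminf at_top (\<lambda>t. ereal (r t / \<gamma> t))"
    using ereal_dense2[OF assms(7)] by (auto simp: one_ereal_def)
  from less_LiminfD[OF \<rho>(2)] obtain T1 where T1: "\<And>t. T1 \<le> t \<Longrightarrow> \<rho> < r t / \<gamma> t"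
    by (auto simp: eventually_at_top_linorder)
  have int: "integrable (lebesgue_on {s..t}) \<gamma>" if "0 \<le> s" "s \<le> t" for s t
    using rates that by (intro integrable_subinterval[of 0 t \<gamma> s t]) auto
  have "\<exists>T2. (\<exists>K. \<forall>t\<ge>T2. r t < K * \<gamma> t) \<or> (\<exists>B. \<forall>t\<ge>0. integral {t..t + \<tau>} \<gamma> \<le> B)"
    using rates[THEN conjunct2]
  proof
    assume "Limsup at_top (\<lambda>t. ereal (r t / \<gamma> t)) < \<infinity>"
    then obtain K where "Limsup at_top (\<lambda>t. ereal (r t / \<gamma> t)) < ereal K"
      using ereal_dense2 by blast
    from Limsup_lessD[OF this] obtain T2 where T2: "\<And>t. T2 \<le> t \<Longrightarrow> r t / \<gamma> t < K"
      by (auto simp: eventually_at_top_linorder)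
    \<comment> \<open>The maximum with \<open>0\<close> ensures that \<open>\<gamma> t\<close> is
      positive, so the quotient bound can be multiplied out.\<close>
    have "r t < K * \<gamma> t" if "max T2 0 \<le> t" for t
      using T2[of t] assms(4) that by (simp add: pos_divide_less_eq)
    then show ?thesis
      by blast
  next
    assume "\<exists>B. \<forall>t\<ge>0. integral\<^sup>L (lebesgue_on {t..t + \<tau>}) \<gamma> \<le> B"
    then obtain B where B: "\<forall>t\<ge>0. integral\<^sup>L (lebesgue_on {t..t + \<tau>}) \<gamma> \<le> B" ..
    have "integral {t..t + \<tau>} \<gamma> \<le> B" if "0 \<le> t" for t
      using B[rule_format, OF that] int[of t "t + \<tau>"] that \<open>\<tau> > 0\<close>
      by (simp add: lebesgue_integral_eq_integral)
    then show ?thesis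
      by blast
  qed
  then obtain T2 where
    T2: "(\<exists>K. \<forall>t\<ge>T2. r t < K * \<gamma> t) \<or> (\<exists>B. \<forall>t\<ge>0. integral {t..t + \<tau>} \<gamma> \<le> B)" ..
  define T where "T = Max {\<tau>, T1, T2}"
  have T: "\<tau> \<le> T" "T1 \<le> T" "T2 \<le> T"
    by (auto simp: T_def)
  have "\<exists>m>0. \<forall>t\<ge>0. m \<le> x t"
  proof (rule MG_persistence)
    show "MG_solution \<tau> p \<gamma> r \<phi> x"
      using x by blast
    show "\<gamma> integrable_on {0..S}" for S
      using int[of 0 S] by (cases "0 \<le> S") (auto simp: integrable_on_lebesgue_on)
    show "0 < \<phi> t" if "- \<tau> \<le> t" "t \<le> 0" for t
    proof -
      have "(INF t\<in>{-\<tau>..0}. ereal (\<phi> t)) \<le> ereal (\<phi> t)"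
        using that by (intro INF_lower) simp
      then show ?thesis
        using x by (metis ereal_less(2) order_less_le_trans)
    qed
    show "\<rho> * \<gamma> t \<le> r t" if "T \<le> t" for t
      using T1[of t] assms(1,4) T that by (simp add: pos_less_divide_eq)
    show "(\<exists>K. \<forall>t\<ge>T. r t \<le> K * \<gamma> t) \<or> (\<exists>B. \<forall>t\<ge>0. integral {t..t + \<tau>} \<gamma> \<le> B)"
      using T2 T(3) by (meson less_eq_real_def order_trans)
  qed (use assms \<rho> T in \<open>simp_all add: less_imp_le\<close>)
  then obtain m where m: "m > 0" "\<And>t. 0 \<le> t \<Longrightarrow> m \<le> x t"
    by blast
  have "0 < ereal m"
    using m by simp
  also have "ereal m \<le> (INF t\<in>{0..}. ereal (x t))"
    using m(2) by (intro INF_greatest) simp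
  finally show "(INF t\<in>{0..}. ereal (x t)) > 0" .
next
  fix g k
  assume const: "\<forall>t\<ge>0. \<gamma> t = g \<and> r t = k"
  then have "0 < g"
    using assms(4) by (metis order_refl)
  have "Liminf at_top (\<lambda>t. ereal (r t / \<gamma> t)) = Liminf at_top (\<lambda>t::real. ereal (k / g))"
    using const by (intro Liminf_eq eventually_at_top_linorderI[of 0]) simp
  then have "1 < ereal (k / g)"
    using assms(7) by (simp add: Liminf_const)
  then have kg: "1 < k / g"
    by (simp add: one_ereal_def)
  then show "g < k"
    using \<open>0 < g\<close> by (simp add: pos_less_divide_eq)
  \<comment> \<open>Solves \<open>k / (1 + c powr p) = g\<close>; it is positive because
    \<open>k / g > 1\<close>.\<close>
  define c where "c = (k / g - 1) powr (1 / p)"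
  have "0 < c" "c powr p = k / g - 1"
    using kg \<open>p > 1\<close> by (auto simp: c_def powr_powr)
  then have eq: "k / (1 + c powr p) = g"
    using kg \<open>0 < g\<close> by auto
  let ?\<nu> = "return (C_borel \<tau>) (\<lambda>\<theta>\<in>{-\<tau>..0}. c)"
  have \<mu>: "distr ?\<nu> borel (\<lambda>\<phi>. \<phi> 0) = return borel c"
    using \<open>\<tau> > 0\<close> const_in_C_borel[of c \<tau>]
    by (subst distr_return) (auto intro: eval_measurable_C_borel)
  \<comment> \<open>The two Dirac measures on segments are separated by their push-forwards under
    evaluation at \<open>0\<close>, which give \<open>{c}\<close> different masses.\<close>
  have "distr (return (C_borel \<tau>) (\<lambda>\<theta>\<in>{-\<tau>..0}. 0)) borel (\<lambda>\<phi>. \<phi> 0) = return borel (0::real)"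
    using \<open>\<tau> > 0\<close> const_in_C_borel[of 0 \<tau>]
    by (subst distr_return) (auto intro: eval_measurable_C_borel)
  moreover have "emeasure (return borel c) {c} \<noteq> emeasure (return borel 0) {c}"
    using \<open>0 < c\<close> by simp
  ultimately have "?\<nu> \<noteq> return (C_borel \<tau>) (\<lambda>\<theta>\<in>{-\<tau>..0}. 0)"
    using \<mu> by metis
  moreover have "\<exists>m M. m > 0 \<and> M > 0 \<and> measure (return borel c) {m..M} = 1"
    \<comment> \<open>Both endpoints are \<open>c\<close>, as the stationary distribution is
      concentrated at that point.\<close>
    using \<open>0 < c\<close> by (intro exI[of _ c]) (simp add: measure_def)
  ultimately show "\<exists>\<nu>. MG_invariant \<tau> p g k \<nu> \<and>
             \<nu> \<noteq> return (C_borel \<tau>) (\<lambda>\<theta>\<in>{-\<tau>..0}. 0) \<and>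
             (let \<mu> = distr \<nu> borel (\<lambda>\<phi>. \<phi> 0) in
                MG_stationary \<tau> p g k \<mu> \<and>
                (\<exists>m M. m > 0 \<and> M > 0 \<and> measure \<mu> {m..M} = 1))"
    using MG_invariant_equilibrium[OF \<open>\<tau> > 0\<close> less_imp_le[OF \<open>0 < g\<close>] eq]
      MG_stationary_equilibrium[OF \<open>\<tau> > 0\<close> eq] \<mu>
    unfolding Let_def by (intro exI[of _ ?\<nu>]) simp
qed

end
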